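(* Let $M^{2n+1}(f,Q,\xi,\eta,g)$ be a weak quasi-contact metric manifold satisfying $$(\nabla_X f)Y=g(X,Y)\,\xi-\eta(Y)X\qquad (X,Y\in\mathfrak{X}_M).$$ Then $Q={\rm id}$ and $M(f,\xi,\eta,g)$ is a Sasakian manifold.
   Context: $\mathfrak{X}_M$ denotes the Lie algebra of smooth vector fields on a smooth manifold $M$ of dimension $2n+1$, and $\nabla$ is the Levi-Civita connection of $g$. A weak almost-contact metric structure $(f,Q,\xi,\eta,g)$ on $M^{2n+1}$ consists of a $(1,1)$-tensor $f$, a nonsingular $(1,1)$-tensor $Q$, a vector field $\xi$, a 1-form $\eta$ and a Riemannian metric $g$ such that $f^2=-Q+\eta\otimes\xi$, $\eta(\xi)=1$, $g(fX,fY)=g(X,QY)-\eta(X)\eta(Y)$, $\eta(X)=g(\xi,X)$ for all $X,Y\in\mathfrak{X}_M$. (Then $f\xi=0$, $\eta\circ f=0$, $\eta\circ Q=\eta$, $Q\xi=\xi$, $Qf=fQ$, $f$ is skew-symmetric, $Q$ is self-adjoint and positive definite, and ${\rm rank}\,f=2n$.) When $Q={\rm id}$, the structure $(f,\xi,\eta,g)$ is called an almost-contact metric structure. The $(1,1)$-tensor $h$ is $h=\frac12\,\mathcal{L}_\xi f$, where $(\mathcal{L}_Z f)X=[Z,fX]-f[Z,X]$. A weak quasi-contact metric manifold is one with a weak almost-contact metric structure satisfying, for all $X,Y\in\mathfrak{X}_M$, $$(\nabla_X f)Y+(\nabla_{fX}f)fY=2\,g(X,Y)\,\xi-\eta(Y)\big(X+hX+\eta(X)\,\xi\big).$$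 A contact metric manifold is an almost-contact metric manifold with $d\eta=\Phi$, where $\Phi(X,Y)=g(X,fY)$ and $2\,d\eta(X,Y)=X(\eta(Y))-Y(\eta(X))-\eta([X,Y])$. A Sasakian manifold is a contact metric manifold that is normal, i.e., $[f,f]+2\,d\eta\otimes\xi=0$, where $[f,f](X,Y)=f^2[X,Y]+[fX,fY]-f[fX,Y]-f[X,fY]$. Equivalently (a classical fact), it is an almost-contact metric manifold with $(\nabla_X f)Y=g(X,Y)\,\xi-\eta(Y)X$ for all $X,Y$. *)

theory Defs
  imports "HOL-Analysis.Analysis" "HOL-Library.Function_Algebras"
begin

section \<open>Smooth maps between Euclidean spaces\<close>

text \<open>Only used on open sets \<open>S\<close>. In finite dimension, continuity of all directional
  derivatives is continuity of the derivative.\<close>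

primrec C_k_on :: "nat \<Rightarrow> 'e::euclidean_space set \<Rightarrow> ('e \<Rightarrow> 'f::real_normed_vector) \<Rightarrow> bool" where
  "C_k_on 0 S u \<longleftrightarrow> continuous_on S u"
| "C_k_on (Suc k) S u \<longleftrightarrow>
     (\<forall>x\<in>S. u differentiable (at x)) \<and>
     (\<forall>v. C_k_on k S (\<lambda>x. frechet_derivative u (at x) v))"

definition smooth_on :: "'e::euclidean_space set \<Rightarrow> ('e \<Rightarrow> 'f::real_normed_vector) \<Rightarrow> bool" where
  "smooth_on S u \<longleftrightarrow> (\<forall>k. C_k_on k S u)"


section \<open>Smooth manifolds\<close>

text \<open>A chart is a pair of its domain and its coordinate map, the latter being relevant only on
  the domain. The atlas need not be maximal: it determines the smooth structure.\<close>

record ('m, 'e) manifold =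
  mtop :: "'m topology"
  atlas :: "('m set \<times> ('m \<Rightarrow> 'e)) set"

abbreviation points :: "('m, 'e) manifold \<Rightarrow> 'm set" where
  "points M \<equiv> topspace (mtop M)"

definition smooth_manifold :: "nat \<Rightarrow> ('m, 'e::euclidean_space) manifold \<Rightarrow> bool" where
  "smooth_manifold d M \<longleftrightarrow>
     DIM('e) = d \<and> Hausdorff_space (mtop M) \<and> second_countable (mtop M) \<and>
     (\<Union>(U, c)\<in>atlas M. U) = points M \<and>
     (\<forall>(U, c)\<in>atlas M. openin (mtop M) U \<and> open (c ` U) \<and>
        homeomorphic_map (subtopology (mtop M) U) (top_of_set (c ` U)) c) \<and>
     (\<forall>(U, c)\<in>atlas M. \<forall>(V, c')\<in>atlas M. smooth_on (c ` (U \<inter> V)) (c' \<circ> inv_into U c))"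

text \<open>Functions are total in HOL. Real functions on \<open>M\<close> are made to vanish off the point set of
  \<open>M\<close>, tangent vectors to vanish off the smooth functions, and vector fields to vanish off the
  point set. Equality of functions or of vector fields on \<open>M\<close> is then equality in HOL.\<close>

definition smooth_functions :: "('m, 'e::euclidean_space) manifold \<Rightarrow> ('m \<Rightarrow> real) set" where
  "smooth_functions M = {\<phi>. (\<forall>p. p \<notin> points M \<longrightarrow> \<phi> p = 0) \<and>
     (\<forall>(U, c)\<in>atlas M. smooth_on (c ` U) (\<phi> \<circ> inv_into U c))}"

text \<open>Tangent vectors at \<open>p\<close> are the derivations at \<open>p\<close> of the algebra of smooth functions.\<close>

definition tangent_space ::
    "('m, 'e::euclidean_space) manifold \<Rightarrow> 'm \<Rightarrow> (('m \<Rightarrow> real) \<Rightarrow> real) set" where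
  "tangent_space M p = {v.
     (\<forall>\<phi>. \<phi> \<notin> smooth_functions M \<longrightarrow> v \<phi> = 0) \<and>
     (\<forall>\<phi>\<in>smooth_functions M. \<forall>\<psi>\<in>smooth_functions M. v (\<phi> + \<psi>) = v \<phi> + v \<psi>) \<and>
     (\<forall>a. \<forall>\<phi>\<in>smooth_functions M. v (\<lambda>q. a * \<phi> q) = a * v \<phi>) \<and>
     (\<forall>\<phi>\<in>smooth_functions M. \<forall>\<psi>\<in>smooth_functions M. v (\<phi> * \<psi>) = \<phi> p * v \<psi> + \<psi> p * v \<phi>)}"

type_synonym 'm vfield = "'m \<Rightarrow> ('m \<Rightarrow> real) \<Rightarrow> real"

definition vf_apply :: "'m vfield \<Rightarrow> ('m \<Rightarrow> real) \<Rightarrow> 'm \<Rightarrow> real" where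
  "vf_apply X \<phi> = (\<lambda>p. X p \<phi>)"

definition vector_fields :: "('m, 'e::euclidean_space) manifold \<Rightarrow> 'm vfield set" where
  "vector_fields M = {X. (\<forall>p\<in>points M. X p \<in> tangent_space M p) \<and>
     (\<forall>p. p \<notin> points M \<longrightarrow> X p = 0) \<and>
     (\<forall>\<phi>\<in>smooth_functions M. vf_apply X \<phi> \<in> smooth_functions M)}"

definition vf_scale :: "('m \<Rightarrow> real) \<Rightarrow> 'm vfield \<Rightarrow> 'm vfield" (infixr "\<odot>" 75) where
  "\<phi> \<odot> X = (\<lambda>p \<psi>. \<phi> p * X p \<psi>)"

definition lie_bracket :: "'m vfield \<Rightarrow> 'm vfield \<Rightarrow> 'm vfield" where
  "lie_bracket X Y = (\<lambda>p \<phi>. X p (vf_apply Y \<phi>) - Y p (vf_apply X \<phi>))"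


section \<open>Tensor fields and connections\<close>

text \<open>Tensor fields are the maps on vector fields that are multilinear over the smooth functions;
  their values on arguments which are not vector fields on \<open>M\<close> are irrelevant.\<close>

definition one_form ::
    "('m, 'e::euclidean_space) manifold \<Rightarrow> ('m vfield \<Rightarrow> 'm \<Rightarrow> real) \<Rightarrow> bool" where
  "one_form M \<eta> \<longleftrightarrow>
     (\<forall>X\<in>vector_fields M. \<eta> X \<in> smooth_functions M) \<and>
     (\<forall>X\<in>vector_fields M. \<forall>Y\<in>vector_fields M. \<eta> (X + Y) = \<eta> X + \<eta> Y) \<and>
     (\<forall>\<phi>\<in>smooth_functions M. \<forall>X\<in>vector_fields M. \<eta> (\<phi> \<odot> X) = \<phi> * \<eta> X)"

definition tensor_1_1 ::
    "('m, 'e::euclidean_space) manifold \<Rightarrow> ('m vfield \<Rightarrow> 'm vfield) \<Rightarrow> bool" where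
  "tensor_1_1 M f \<longleftrightarrow>
     (\<forall>X\<in>vector_fields M. f X \<in> vector_fields M) \<and>
     (\<forall>X\<in>vector_fields M. \<forall>Y\<in>vector_fields M. f (X + Y) = f X + f Y) \<and>
     (\<forall>\<phi>\<in>smooth_functions M. \<forall>X\<in>vector_fields M. f (\<phi> \<odot> X) = \<phi> \<odot> f X)"

definition nonsingular_tensor ::
    "('m, 'e::euclidean_space) manifold \<Rightarrow> ('m vfield \<Rightarrow> 'm vfield) \<Rightarrow> bool" where
  "nonsingular_tensor M Q \<longleftrightarrow>
     tensor_1_1 M Q \<and> bij_betw Q (vector_fields M) (vector_fields M)"

definition riemannian_metric ::
    "('m, 'e::euclidean_space) manifold \<Rightarrow> ('m vfield \<Rightarrow> 'm vfield \<Rightarrow> 'm \<Rightarrow> real) \<Rightarrow> bool" where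
  "riemannian_metric M g \<longleftrightarrow>
     (\<forall>X\<in>vector_fields M. one_form M (g X)) \<and>
     (\<forall>X\<in>vector_fields M. \<forall>Y\<in>vector_fields M. g X Y = g Y X) \<and>
     (\<forall>X\<in>vector_fields M. \<forall>p\<in>points M. X p \<noteq> 0 \<longrightarrow> g X X p > 0)"

definition affine_connection ::
    "('m, 'e::euclidean_space) manifold \<Rightarrow> ('m vfield \<Rightarrow> 'm vfield \<Rightarrow> 'm vfield) \<Rightarrow> bool" where
  "affine_connection M nab \<longleftrightarrow>
     (\<forall>Y\<in>vector_fields M. tensor_1_1 M (\<lambda>X. nab X Y)) \<and>
     (\<forall>X\<in>vector_fields M. \<forall>Y\<in>vector_fields M. \<forall>Z\<in>vector_fields M.
        nab X (Y + Z) = nab X Y + nab X Z) \<and>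
     (\<forall>\<phi>\<in>smooth_functions M. \<forall>X\<in>vector_fields M. \<forall>Y\<in>vector_fields M.
        nab X (\<phi> \<odot> Y) = \<phi> \<odot> nab X Y + vf_apply X \<phi> \<odot> Y)"

definition levi_civita_connection ::
    "('m, 'e::euclidean_space) manifold \<Rightarrow> ('m vfield \<Rightarrow> 'm vfield \<Rightarrow> 'm \<Rightarrow> real) \<Rightarrow>
     ('m vfield \<Rightarrow> 'm vfield \<Rightarrow> 'm vfield) \<Rightarrow> bool" where
  "levi_civita_connection M g nab \<longleftrightarrow>
     affine_connection M nab \<and>
     (\<forall>X\<in>vector_fields M. \<forall>Y\<in>vector_fields M. nab X Y - nab Y X = lie_bracket X Y) \<and>
     (\<forall>X\<in>vector_fields M. \<forall>Y\<in>vector_fields M. \<forall>Z\<in>vector_fields M.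
        vf_apply X (g Y Z) = g (nab X Y) Z + g Y (nab X Z))"

definition cov_deriv ::
    "('m vfield \<Rightarrow> 'm vfield \<Rightarrow> 'm vfield) \<Rightarrow> 'm vfield \<Rightarrow> ('m vfield \<Rightarrow> 'm vfield) \<Rightarrow>
     'm vfield \<Rightarrow> 'm vfield" where
  "cov_deriv nab X f Y = nab X (f Y) - f (nab X Y)"

definition lie_derivative ::
    "'m vfield \<Rightarrow> ('m vfield \<Rightarrow> 'm vfield) \<Rightarrow> 'm vfield \<Rightarrow> 'm vfield" where
  "lie_derivative Z f X = lie_bracket Z (f X) - f (lie_bracket Z X)"

text \<open>The exterior derivative of a 1-form, in the normalisation with factor \<open>1/2\<close>.\<close>

definition ext_deriv ::
    "('m vfield \<Rightarrow> 'm \<Rightarrow> real) \<Rightarrow> 'm vfield \<Rightarrow> 'm vfield \<Rightarrow> 'm \<Rightarrow> real" where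
  "ext_deriv \<eta> X Y =
     (\<lambda>p. (vf_apply X (\<eta> Y) p - vf_apply Y (\<eta> X) p - \<eta> (lie_bracket X Y) p) / 2)"

definition nijenhuis ::
    "('m vfield \<Rightarrow> 'm vfield) \<Rightarrow> 'm vfield \<Rightarrow> 'm vfield \<Rightarrow> 'm vfield" where
  "nijenhuis f X Y = f (f (lie_bracket X Y)) + lie_bracket (f X) (f Y)
     - f (lie_bracket (f X) Y) - f (lie_bracket X (f Y))"


section \<open>Weak almost-contact metric structures\<close>

definition weak_almost_contact_metric ::
    "('m, 'e::euclidean_space) manifold \<Rightarrow> ('m vfield \<Rightarrow> 'm vfield) \<Rightarrow> ('m vfield \<Rightarrow> 'm vfield) \<Rightarrow>
     'm vfield \<Rightarrow> ('m vfield \<Rightarrow> 'm \<Rightarrow> real) \<Rightarrow> ('m vfield \<Rightarrow> 'm vfield \<Rightarrow> 'm \<Rightarrow> real) \<Rightarrow> bool" where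
  "weak_almost_contact_metric M f Q \<xi> \<eta> g \<longleftrightarrow>
     tensor_1_1 M f \<and> nonsingular_tensor M Q \<and> \<xi> \<in> vector_fields M \<and> one_form M \<eta> \<and>
     riemannian_metric M g \<and>
     (\<forall>X\<in>vector_fields M. f (f X) = - Q X + \<eta> X \<odot> \<xi>) \<and>
     (\<forall>p\<in>points M. \<eta> \<xi> p = 1) \<and>
     (\<forall>X\<in>vector_fields M. \<forall>Y\<in>vector_fields M. g (f X) (f Y) = g X (Q Y) - \<eta> X * \<eta> Y) \<and>
     (\<forall>X\<in>vector_fields M. \<eta> X = g \<xi> X)"

definition almost_contact_metric ::
    "('m, 'e::euclidean_space) manifold \<Rightarrow> ('m vfield \<Rightarrow> 'm vfield) \<Rightarrow>
     'm vfield \<Rightarrow> ('m vfield \<Rightarrow> 'm \<Rightarrow> real) \<Rightarrow> ('m vfield \<Rightarrow> 'm vfield \<Rightarrow> 'm \<Rightarrow> real) \<Rightarrow> bool" where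
  "almost_contact_metric M f \<xi> \<eta> g \<longleftrightarrow> weak_almost_contact_metric M f (\<lambda>X. X) \<xi> \<eta> g"

definition tensor_h :: "('m vfield \<Rightarrow> 'm vfield) \<Rightarrow> 'm vfield \<Rightarrow> 'm vfield \<Rightarrow> 'm vfield" where
  "tensor_h f \<xi> X = (\<lambda>_. 1/2) \<odot> lie_derivative \<xi> f X"

text \<open>Here \<open>nab\<close> is meant to be the Levi-Civita connection of \<open>g\<close>.\<close>

definition weak_quasi_contact_metric ::
    "('m, 'e::euclidean_space) manifold \<Rightarrow> ('m vfield \<Rightarrow> 'm vfield \<Rightarrow> 'm vfield) \<Rightarrow>
     ('m vfield \<Rightarrow> 'm vfield) \<Rightarrow> ('m vfield \<Rightarrow> 'm vfield) \<Rightarrow>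
     'm vfield \<Rightarrow> ('m vfield \<Rightarrow> 'm \<Rightarrow> real) \<Rightarrow> ('m vfield \<Rightarrow> 'm vfield \<Rightarrow> 'm \<Rightarrow> real) \<Rightarrow> bool" where
  "weak_quasi_contact_metric M nab f Q \<xi> \<eta> g \<longleftrightarrow>
     weak_almost_contact_metric M f Q \<xi> \<eta> g \<and>
     (\<forall>X\<in>vector_fields M. \<forall>Y\<in>vector_fields M.
        cov_deriv nab X f Y + cov_deriv nab (f X) f (f Y)
        = (\<lambda>p. 2 * g X Y p) \<odot> \<xi> - \<eta> Y \<odot> (X + tensor_h f \<xi> X + \<eta> X \<odot> \<xi>))"

definition contact_metric ::
    "('m, 'e::euclidean_space) manifold \<Rightarrow> ('m vfield \<Rightarrow> 'm vfield) \<Rightarrow>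
     'm vfield \<Rightarrow> ('m vfield \<Rightarrow> 'm \<Rightarrow> real) \<Rightarrow> ('m vfield \<Rightarrow> 'm vfield \<Rightarrow> 'm \<Rightarrow> real) \<Rightarrow> bool" where
  "contact_metric M f \<xi> \<eta> g \<longleftrightarrow>
     almost_contact_metric M f \<xi> \<eta> g \<and>
     (\<forall>X\<in>vector_fields M. \<forall>Y\<in>vector_fields M. ext_deriv \<eta> X Y = g X (f Y))"

definition sasakian ::
    "('m, 'e::euclidean_space) manifold \<Rightarrow> ('m vfield \<Rightarrow> 'm vfield) \<Rightarrow>
     'm vfield \<Rightarrow> ('m vfield \<Rightarrow> 'm \<Rightarrow> real) \<Rightarrow> ('m vfield \<Rightarrow> 'm vfield \<Rightarrow> 'm \<Rightarrow> real) \<Rightarrow> bool" where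
  "sasakian M f \<xi> \<eta> g \<longleftrightarrow>
     contact_metric M f \<xi> \<eta> g \<and>
     (\<forall>X\<in>vector_fields M. \<forall>Y\<in>vector_fields M.
        nijenhuis f X Y + (\<lambda>p. 2 * ext_deriv \<eta> X Y p) \<odot> \<xi> = 0)"

end

theory Submission
  imports Defs
begin

text \<open>Write \<open>h\<close> for half the Lie derivative of \<open>f\<close> along \<open>\<xi>\<close>. Inserting
  \<open>(\<nabla>\<^sub>X f) Y = g(X,Y) \<xi> - \<eta>(Y) X\<close> twice into the weak quasi-contact identity leaves the
  algebraic equation
  \<open>g(X, Q Y - Y) \<xi> = \<eta>(f Y) f X - \<eta>(Y) h X\<close>.
  Suppose that \<open>\<eta> \<circ> f = 0\<close> is known. Then \<open>f \<xi> = 0\<close> and \<open>Q \<xi> = \<xi>\<close>, so \<open>Y = \<xi>\<close> gives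
  \<open>h = 0\<close>, and what remains says that \<open>g(X, Q Y - Y) = 0\<close> for all \<open>X\<close>, whence \<open>Q Y = Y\<close>.

  The algebraic identities of a weak almost-contact metric structure do not imply
  \<open>\<eta> \<circ> f = 0\<close>: for every skew-symmetric \<open>f\<close> and unit vector \<open>\<xi>\<close> they hold with
  \<open>Q = - f\<^sup>2 + \<eta> \<otimes> \<xi>\<close>, and this \<open>Q\<close> may be nonsingular although \<open>f \<xi> \<noteq> 0\<close>. Here
  \<open>\<eta> \<circ> f = 0\<close> comes from the equation above, in two steps. Eliminating \<open>h\<close> from it by means
  of its instance \<open>Y = \<xi>\<close> shows that \<open>\<eta>(f Y) - \<eta>(f \<xi>) \<eta>(Y)\<close> can be nonzero at a point only if
  \<open>f\<close> has values in the span of \<open>\<xi>\<close> there, which leads to a contradiction; so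
  \<open>\<eta> \<circ> f = b \<eta>\<close> with \<open>b = \<eta>(f \<xi>)\<close> (\<open>eta_f_proportional\<close>). Differentiating
  \<open>g(f \<xi>, f \<xi>) = - \<eta>(f (f \<xi>))\<close> then forces \<open>b = 0\<close> (\<open>eta_f_xi_eq_zero\<close>).

  Once \<open>Q\<close> is the identity, the classical argument applies (\<open>sasakian_if_Q_identity\<close>): the
  derivative of \<open>f\<close> at \<open>\<xi>\<close> gives \<open>\<nabla>\<^sub>X \<xi> = - f X\<close>, so that \<open>d\<eta> = \<Phi>\<close>, and the torsion-free
  expression of the Nijenhuis tensor through \<open>\<nabla> f\<close> evaluates to \<open>- 2 d\<eta> \<otimes> \<xi>\<close>.\<close>

section \<open>Closure properties of smooth functions\<close>

text \<open>On an open set, the derivatives of a function depend only on its values there. This is what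
  lets the sum and product rules, valid only where both functions are differentiable, be used
  under \<open>C_k_on\<close>, whose recursion evaluates the total function \<open>frechet_derivative\<close>.\<close>

lemma C_k_on_cong:
  assumes "open S" and "\<And>x. x \<in> S \<Longrightarrow> u x = v x" and "C_k_on k S u"
  shows "C_k_on k S v"
  using assms(2,3)
proof (induction k arbitrary: u v)
  case 0
  then show ?case by (simp cong: continuous_on_cong)
next
  case (Suc k)
  have der: "(v has_derivative frechet_derivative u (at x)) (at x)" if "x \<in> S" for x
  proof -
    have "(u has_derivative frechet_derivative u (at x)) (at x)"
      using Suc.prems that by (simp flip: frechet_derivative_works)
    then show ?thesis
      using has_derivative_transform_within_open[OF _ assms(1) that] Suc.prems(1) by blast
  qed
  have "frechet_derivative v (at x) = frechet_derivative u (at x)" if "x \<in> S" for x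
    using frechet_derivative_at[OF der[OF that]] by simp
  then have "C_k_on k S (\<lambda>x. frechet_derivative v (at x) w)" for w
    using Suc.IH[of "\<lambda>x. frechet_derivative u (at x) w" "\<lambda>x. frechet_derivative v (at x) w"]
      Suc.prems(2) by simp
  then show ?case
    using der by (auto simp: differentiable_def)
qed

lemma C_k_on_const: "C_k_on k S (\<lambda>_. c)"
proof (induction k arbitrary: c)
  case (Suc k)
  show ?case using Suc[of 0] by (simp add: frechet_derivative_const)
qed simp

lemma C_k_on_add:
  assumes "open S" and "C_k_on k S u" and "C_k_on k S v"
  shows "C_k_on k S (\<lambda>x. u x + v x)"
  using assms(2,3)
proof (induction k arbitrary: u v)
  case 0
  then show ?case by (simp add: continuous_on_add)
next
  case (Suc k)
  have d: "frechet_derivative (\<lambda>x. u x + v x) (at x) w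
      = frechet_derivative u (at x) w + frechet_derivative v (at x) w" if "x \<in> S" for x w
  proof -
    have "((\<lambda>x. u x + v x) has_derivative
        (\<lambda>w. frechet_derivative u (at x) w + frechet_derivative v (at x) w)) (at x)"
      using Suc.prems that
      by (intro has_derivative_add) (simp_all flip: frechet_derivative_works)
    from frechet_derivative_at[OF this] show ?thesis by metis
  qed
  have "C_k_on k S (\<lambda>x. frechet_derivative (\<lambda>x. u x + v x) (at x) w)" for w
    by (rule C_k_on_cong[OF assms(1) _ Suc.IH]) (use Suc.prems d in auto)
  then show ?case using Suc.prems by (simp add: differentiable_add)
qed

lemma C_k_on_Suc_imp: "C_k_on (Suc k) S u \<Longrightarrow> C_k_on k S u"
proof (induction k arbitrary: u)
  case 0
  then show ?case
    by (simp add: continuous_at_imp_continuous_on differentiable_imp_continuous_within)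
next
  case (Suc k)
  then show ?case by (metis C_k_on.simps(2))
qed

lemma C_k_on_mult:
  fixes u v :: "'e::euclidean_space \<Rightarrow> real"
  assumes "open S" and "C_k_on k S u" and "C_k_on k S v"
  shows "C_k_on k S (\<lambda>x. u x * v x)"
  using assms(2,3)
proof (induction k arbitrary: u v)
  case 0
  then show ?case by (simp add: continuous_on_mult)
next
  case (Suc k)
  have d: "frechet_derivative (\<lambda>x. u x * v x) (at x) w
      = u x * frechet_derivative v (at x) w + frechet_derivative u (at x) w * v x"
    if "x \<in> S" for x w
  proof -
    have "((\<lambda>x. u x * v x) has_derivative (\<lambda>w. u x * frechet_derivative v (at x) w
        + frechet_derivative u (at x) w * v x)) (at x)"
      using Suc.prems that by (intro has_derivative_mult) (simp_all flip: frechet_derivative_works)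
    from frechet_derivative_at[OF this] show ?thesis by metis
  qed
  have "C_k_on k S (\<lambda>x. frechet_derivative (\<lambda>x. u x * v x) (at x) w)" for w
  proof (rule C_k_on_cong[OF assms(1)])
    show "C_k_on k S (\<lambda>x. u x * frechet_derivative v (at x) w + frechet_derivative u (at x) w * v x)"
      using Suc.prems C_k_on_Suc_imp[of k S u] C_k_on_Suc_imp[of k S v]
      by (intro C_k_on_add[OF assms(1)] Suc.IH) auto
  qed (simp add: d)
  then show ?case using Suc.prems by (simp add: differentiable_mult)
qed

context
  fixes M :: "('m, 'e::euclidean_space) manifold" and d :: nat
  assumes manifold: "smooth_manifold d M"
begin

lemma open_chart_image: "(U, c) \<in> atlas M \<Longrightarrow> open (c ` U)"
  using manifold by (auto simp: smooth_manifold_def)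

lemma smooth_functions_add:
  assumes "\<phi> \<in> smooth_functions M" and "\<psi> \<in> smooth_functions M"
  shows "\<phi> + \<psi> \<in> smooth_functions M"
  using assms C_k_on_add[OF open_chart_image]
  by (fastforce simp: smooth_functions_def smooth_on_def comp_def)

lemma smooth_functions_mult:
  assumes "\<phi> \<in> smooth_functions M" and "\<psi> \<in> smooth_functions M"
  shows "\<phi> * \<psi> \<in> smooth_functions M"
  using assms C_k_on_mult[OF open_chart_image]
  by (fastforce simp: smooth_functions_def smooth_on_def comp_def)

lemma smooth_functions_scale:
  assumes "\<phi> \<in> smooth_functions M"
  shows "(\<lambda>p. a * \<phi> p) \<in> smooth_functions M"
  using assms C_k_on_mult[OF open_chart_image C_k_on_const]
  by (fastforce simp: smooth_functions_def smooth_on_def comp_def)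


section \<open>The module of vector fields\<close>

lemma vector_fields_add:
  assumes X: "X \<in> vector_fields M" and Y: "Y \<in> vector_fields M"
  shows "X + Y \<in> vector_fields M"
proof -
  have "vf_apply (X + Y) \<phi> = vf_apply X \<phi> + vf_apply Y \<phi>" for \<phi>
    by (simp add: vf_apply_def fun_eq_iff)
  then show ?thesis
    using X Y smooth_functions_add
    by (auto simp: vector_fields_def tangent_space_def algebra_simps)
qed

lemma vector_fields_scale:
  assumes "\<phi> \<in> smooth_functions M" and X: "X \<in> vector_fields M"
  shows "\<phi> \<odot> X \<in> vector_fields M"
proof -
  have "vf_apply (\<phi> \<odot> X) \<psi> = \<phi> * vf_apply X \<psi>" for \<psi>
    by (simp add: vf_apply_def vf_scale_def fun_eq_iff)
  then show ?thesis
    using assms smooth_functions_mult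
    by (auto simp: vector_fields_def tangent_space_def vf_scale_def algebra_simps zero_fun_def)
qed

lemma vector_fields_scale_const:
  assumes X: "X \<in> vector_fields M"
  shows "(\<lambda>_. a) \<odot> X \<in> vector_fields M"
proof -
  have "vf_apply ((\<lambda>_. a) \<odot> X) \<psi> = (\<lambda>p. a * vf_apply X \<psi> p)" for \<psi>
    by (simp add: vf_apply_def vf_scale_def fun_eq_iff)
  then show ?thesis
    using assms smooth_functions_scale
    by (auto simp: vector_fields_def tangent_space_def vf_scale_def algebra_simps zero_fun_def)
qed

lemma vector_fields_minus:
  assumes X: "X \<in> vector_fields M"
  shows "- X \<in> vector_fields M"
proof -
  have "- X = (\<lambda>_. - 1) \<odot> X" by (simp add: vf_scale_def fun_eq_iff)
  then show ?thesis using vector_fields_scale_const[OF X] by metis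
qed

lemma vector_fields_diff:
  assumes "X \<in> vector_fields M" and "Y \<in> vector_fields M"
  shows "X - Y \<in> vector_fields M"
  using vector_fields_add[OF assms(1) vector_fields_minus[OF assms(2)]] by simp

lemma vector_fields_zero: "X \<in> vector_fields M \<Longrightarrow> 0 \<in> vector_fields M"
  using vector_fields_diff[of X X] by simp

text \<open>Tensoriality is postulated only for sums and smooth factors. The constant function \<open>- 1\<close> is
  smooth in the present sense only if the manifold fills its type, so compatibility with
  differences has to come from additivity.\<close>

lemma additive_on_vector_fields:
  fixes F :: "'m vfield \<Rightarrow> 'c::ab_group_add"
  assumes add: "\<And>X Y. X \<in> vector_fields M \<Longrightarrow> Y \<in> vector_fields M \<Longrightarrow> F (X + Y) = F X + F Y"
    and X: "X \<in> vector_fields M"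
  shows "F 0 = 0" and "F (- X) = - F X"
    and "Y \<in> vector_fields M \<Longrightarrow> F (X - Y) = F X - F Y"
proof -
  have 0: "F 0 = 0" using add[of 0 0] vector_fields_zero[OF X] by simp
  have min: "F (- Y) = - F Y" if "Y \<in> vector_fields M" for Y
    using add[OF that vector_fields_minus[OF that]] 0 by (simp add: minus_unique)
  show "F 0 = 0" "F (- X) = - F X" using 0 min X by auto
  show "F (X - Y) = F X - F Y" if "Y \<in> vector_fields M"
    using add[OF X vector_fields_minus[OF that]] min[OF that] by simp
qed

lemma vf_apply_minus:
  assumes X: "X \<in> vector_fields M" and \<phi>: "\<phi> \<in> smooth_functions M"
  shows "vf_apply X (- \<phi>) = - vf_apply X \<phi>"
proof
  fix p
  have "- \<phi> = (\<lambda>q. - 1 * \<phi> q)" by (simp add: fun_eq_iff)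
  moreover have "X p (\<lambda>q. - 1 * \<phi> q) = - 1 * X p \<phi>"
  proof (cases "p \<in> points M")
    case True
    then show ?thesis
      using X \<phi> unfolding vector_fields_def tangent_space_def by blast
  next
    case False
    then show ?thesis using X by (simp add: vector_fields_def)
  qed
  ultimately show "vf_apply X (- \<phi>) p = (- vf_apply X \<phi>) p"
    by (simp add: vf_apply_def)
qed

text \<open>The unit of the algebra of smooth functions is idempotent, so the Leibniz rule makes a
  derivation vanish on it.\<close>

lemma vf_apply_one:
  assumes X: "X \<in> vector_fields M" and \<phi>: "\<phi> \<in> smooth_functions M"
    and one: "\<And>p. p \<in> points M \<Longrightarrow> \<phi> p = 1"
  shows "vf_apply X \<phi> = 0"
proof
  fix p
  show "vf_apply X \<phi> p = 0 p"
  proof (cases "p \<in> points M")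
    case True
    have "\<phi> * \<phi> = \<phi>"
      using \<phi> one by (fastforce simp: smooth_functions_def)
    moreover have "X p (\<phi> * \<phi>) = \<phi> p * X p \<phi> + \<phi> p * X p \<phi>"
      using X \<phi> True unfolding vector_fields_def tangent_space_def by blast
    ultimately show ?thesis using one[OF True] by (simp add: vf_apply_def)
  next
    case False
    then show ?thesis using X by (simp add: vector_fields_def vf_apply_def)
  qed
qed

end


section \<open>Algebra of a weak almost-contact metric structure\<close>

locale weak_almost_contact =
  fixes M :: "('m, 'e::euclidean_space) manifold" and d :: nat
    and f Q :: "'m vfield \<Rightarrow> 'm vfield" and \<xi> :: "'m vfield"
    and \<eta> :: "'m vfield \<Rightarrow> 'm \<Rightarrow> real"
    and g :: "'m vfield \<Rightarrow> 'm vfield \<Rightarrow> 'm \<Rightarrow> real"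
  assumes manifold: "smooth_manifold d M"
    and wacm: "weak_almost_contact_metric M f Q \<xi> \<eta> g"
begin

lemmas vf_add [simp] = vector_fields_add[OF manifold]
lemmas vf_diff [simp] = vector_fields_diff[OF manifold]
lemmas vf_scale [simp] = vector_fields_scale[OF manifold]

lemma metric: "riemannian_metric M g"
  using wacm by (simp add: weak_almost_contact_metric_def)

lemma xi_vf [simp]: "\<xi> \<in> vector_fields M"
  using wacm by (simp add: weak_almost_contact_metric_def)

lemma f_vf [simp]: "X \<in> vector_fields M \<Longrightarrow> f X \<in> vector_fields M"
  and f_add: "X \<in> vector_fields M \<Longrightarrow> Y \<in> vector_fields M \<Longrightarrow> f (X + Y) = f X + f Y"
  and f_scale: "\<phi> \<in> smooth_functions M \<Longrightarrow> X \<in> vector_fields M \<Longrightarrow> f (\<phi> \<odot> X) = \<phi> \<odot> f X"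
  using wacm by (simp_all add: weak_almost_contact_metric_def tensor_1_1_def)

lemma Q_vf [simp]: "X \<in> vector_fields M \<Longrightarrow> Q X \<in> vector_fields M"
  using wacm
  by (simp add: weak_almost_contact_metric_def nonsingular_tensor_def tensor_1_1_def)

lemmas f_zero = additive_on_vector_fields(1)[OF manifold f_add xi_vf]
lemmas f_diff = additive_on_vector_fields(3)[OF manifold f_add]

lemma f_f: "X \<in> vector_fields M \<Longrightarrow> f (f X) = - Q X + \<eta> X \<odot> \<xi>"
  and g_f_f: "X \<in> vector_fields M \<Longrightarrow> Y \<in> vector_fields M \<Longrightarrow>
    g (f X) (f Y) = g X (Q Y) - \<eta> X * \<eta> Y"
  and eta_eq: "X \<in> vector_fields M \<Longrightarrow> \<eta> X = g \<xi> X"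
  using wacm by (simp_all add: weak_almost_contact_metric_def)

lemma eta_xi: "p \<in> points M \<Longrightarrow> \<eta> \<xi> p = 1"
  using wacm unfolding weak_almost_contact_metric_def by blast

lemma g_smooth [simp]:
    "X \<in> vector_fields M \<Longrightarrow> Y \<in> vector_fields M \<Longrightarrow> g X Y \<in> smooth_functions M"
  and g_sym: "X \<in> vector_fields M \<Longrightarrow> Y \<in> vector_fields M \<Longrightarrow> g X Y = g Y X"
  and g_add: "X \<in> vector_fields M \<Longrightarrow> Y \<in> vector_fields M \<Longrightarrow> Z \<in> vector_fields M \<Longrightarrow>
    g Z (X + Y) = g Z X + g Z Y"
  and g_scale: "\<phi> \<in> smooth_functions M \<Longrightarrow> Y \<in> vector_fields M \<Longrightarrow> Z \<in> vector_fields M \<Longrightarrow>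
    g Z (\<phi> \<odot> Y) = \<phi> * g Z Y"
  using metric by (simp_all add: riemannian_metric_def one_form_def)

lemma eta_smooth [simp]: "X \<in> vector_fields M \<Longrightarrow> \<eta> X \<in> smooth_functions M"
  by (simp add: eta_eq)

lemma g_diff:
  assumes "X \<in> vector_fields M" "Y \<in> vector_fields M" "Z \<in> vector_fields M"
  shows "g Z (X - Y) = g Z X - g Z Y"
  by (rule additive_on_vector_fields(3)[OF manifold, where F = "g Z"]) (simp_all add: g_add assms)

lemma g_minus:
  assumes "X \<in> vector_fields M" "Z \<in> vector_fields M"
  shows "g Z (- X) = - g Z X"
  by (rule additive_on_vector_fields(2)[OF manifold, where F = "g Z"]) (simp_all add: g_add assms)

lemma smooth_outside: "\<phi> \<in> smooth_functions M \<Longrightarrow> p \<notin> points M \<Longrightarrow> \<phi> p = 0"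
  by (simp add: smooth_functions_def)

lemma eta_xi_mult: "\<phi> \<in> smooth_functions M \<Longrightarrow> \<eta> \<xi> * \<phi> = \<phi>"
  using smooth_outside eta_xi by (fastforce simp: fun_eq_iff)

lemma eta_xi_scale: "X \<in> vector_fields M \<Longrightarrow> \<eta> \<xi> \<odot> X = X"
  using eta_xi by (auto simp: fun_eq_iff vf_scale_def vector_fields_def)

lemma vf_eq_zero:
  assumes X: "X \<in> vector_fields M" and "g X X = 0"
  shows "X = 0"
proof
  fix p
  show "X p = 0 p"
  proof (cases "p \<in> points M")
    case True
    have "\<not> g X X p > 0" using assms(2) by simp
    with True X metric have "X p = 0" unfolding riemannian_metric_def by blast
    then show ?thesis by simp
  next
    case False
    then show ?thesis using X by (simp add: vector_fields_def)
  qed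
qed

text \<open>Both identities involving \<open>Q\<close> express it through \<open>f\<close>; comparing them eliminates \<open>Q\<close>. In
  operator terms, \<open>f\<^sup>* f = - f\<^sup>2\<close>, which is the form in which skew-symmetry of \<open>f\<close> is available
  at first.\<close>

lemma g_f_f_swap:
  assumes "X \<in> vector_fields M" "Y \<in> vector_fields M"
  shows "g (f X) (f Y) = - g X (f (f Y))"
proof -
  have "g X (f (f Y)) = g X (\<eta> Y \<odot> \<xi> - Q Y)"
    using assms by (simp add: f_f)
  also have "\<dots> = \<eta> Y * \<eta> X - g X (Q Y)"
    using assms by (simp add: g_diff g_scale eta_eq g_sym)
  finally show ?thesis using assms by (simp add: g_f_f fun_eq_iff)
qed

text \<open>The map \<open>k\<close> stands for the tensor \<open>h\<close>. Subtracting \<open>\<eta>(Y)\<close> times the hypothesis for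
  \<open>\<xi>\<close> from the one for \<open>Y\<close> removes \<open>k\<close> and leaves
  \<open>c f X\<close> proportional to \<open>\<xi>\<close>, where \<open>c = \<eta>(f Y) - \<eta>(f \<xi>) \<eta>(Y)\<close>. If \<open>c \<noteq> 0\<close> at a point, then
  \<open>f X = \<eta>(f X) \<xi>\<close> there for all \<open>X\<close>, and the relation \<open>f\<^sup>* f = - f\<^sup>2\<close> makes \<open>\<eta> \<circ> f\<close>
  proportional to \<open>\<eta>\<close> after all. Every relation between vector fields at the point is tested
  by its inner products with vector fields.\<close>

lemma eta_f_proportional:
  assumes k: "\<And>X. X \<in> vector_fields M \<Longrightarrow> k X \<in> vector_fields M"
    and eq: "\<And>X Y. X \<in> vector_fields M \<Longrightarrow> Y \<in> vector_fields M \<Longrightarrow>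
      (g X (Q Y) - g X Y) \<odot> \<xi> = \<eta> (f Y) \<odot> f X - \<eta> Y \<odot> k X"
    and Y: "Y \<in> vector_fields M"
  shows "\<eta> (f Y) = \<eta> (f \<xi>) * \<eta> Y"
proof
  fix p
  show "\<eta> (f Y) p = (\<eta> (f \<xi>) * \<eta> Y) p"
  proof (cases "p \<in> points M")
    case False
    then show ?thesis using Y by (simp add: smooth_outside)
  next
    case p: True
    show ?thesis
    proof (rule ccontr)
      assume ne: "\<not> ?thesis"
      define b where "b = \<eta> (f \<xi>) p"
      define c where "c = \<eta> (f Y) p - b * \<eta> Y p"
      have c: "c \<noteq> 0" using ne by (simp add: c_def b_def)
      have eq_p: "(g X (Q W) p - g X W p) * \<eta> Z p
          = \<eta> (f W) p * g (f X) Z p - \<eta> W p * g (k X) Z p"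
        if "X \<in> vector_fields M" "W \<in> vector_fields M" "Z \<in> vector_fields M" for X W Z
      proof -
        have "g Z ((g X (Q W) - g X W) \<odot> \<xi>) = g Z (\<eta> (f W) \<odot> f X - \<eta> W \<odot> k X)"
          using eq that by simp
        moreover have "(g X (Q W) - g X W) \<odot> \<xi> = g X (Q W) \<odot> \<xi> - g X W \<odot> \<xi>"
          by (simp add: fun_eq_iff vf_scale_def algebra_simps)
        ultimately show ?thesis
          using that k g_sym[of _ Z]
          by (simp add: g_diff g_scale eta_eq fun_eq_iff algebra_simps)
      qed
      have span: "g (f X) Z p = \<eta> (f X) p * \<eta> Z p"
        if X: "X \<in> vector_fields M" and Z: "Z \<in> vector_fields M" for X Z
      proof -
        define a where "a = (g X (Q Y) p - g X Y p) - \<eta> Y p * (g X (Q \<xi>) p - g X \<xi> p)"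
        have a: "a * \<eta> W p = c * g (f X) W p" if "W \<in> vector_fields M" for W
          using eq_p[OF X Y that] arg_cong[OF eq_p[OF X xi_vf that], of "\<lambda>r. \<eta> Y p * r"] p
          by (simp add: a_def b_def c_def eta_xi algebra_simps)
        have "a = c * \<eta> (f X) p"
          using a[OF xi_vf] p X by (simp add: eta_xi eta_eq[of "f X"] g_sym)
        with a[OF Z] c show ?thesis by simp
      qed
      have swap: "\<eta> (f X) p * \<eta> (f W) p = - \<eta> (f (f W)) p * \<eta> X p"
        if "X \<in> vector_fields M" "W \<in> vector_fields M" for X W
        using that span[of X "f W"] span[of "f W" X] g_f_f_swap[of X W] g_sym[of X "f (f W)"]
        by simp
      have rank_one: "\<eta> (f X) p * \<eta> (f W) p = b * \<eta> (f W) p * \<eta> X p"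
        if "X \<in> vector_fields M" "W \<in> vector_fields M" for X W
        using swap[OF that] swap[OF xi_vf that(2)] p by (simp add: b_def eta_xi)
      \<comment> \<open>The first of the next two products minus \<open>\<eta>(Y)\<close> times the second is \<open>c\<^sup>2\<close>.\<close>
      have "\<eta> (f Y) p * c = 0"
        using rank_one[OF Y Y] by (simp add: c_def algebra_simps)
      moreover have "b * c = 0"
        using rank_one[OF Y xi_vf] by (simp add: c_def b_def algebra_simps)
      ultimately show False using c by (simp add: c_def)
    qed
  qed
qed

text \<open>The squared length of \<open>f \<xi>\<close> is \<open>- \<eta>(f (f \<xi>))\<close>, so positive definiteness applies.\<close>

lemma f_xi_eq_zero:
  assumes "\<And>Y. Y \<in> vector_fields M \<Longrightarrow> \<eta> (f Y) = 0"
  shows "f \<xi> = 0"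
  using assms[of "f \<xi>"] by (intro vf_eq_zero) (simp_all add: g_f_f_swap flip: eta_eq)

end


section \<open>Consequences of the derivative of the structure tensor\<close>

text \<open>Once every bracket is written through the connection, the terms in which \<open>f\<close> is not
  differentiated cancel between the brackets.\<close>

lemma nijenhuis_cov_deriv:
  assumes torsion: "\<And>X Y. X \<in> vector_fields M \<Longrightarrow> Y \<in> vector_fields M \<Longrightarrow>
      nab X Y - nab Y X = lie_bracket X Y"
    and nab: "\<And>X Y. X \<in> vector_fields M \<Longrightarrow> Y \<in> vector_fields M \<Longrightarrow> nab X Y \<in> vector_fields M"
    and f: "\<And>X. X \<in> vector_fields M \<Longrightarrow> f X \<in> vector_fields M"
    and f_diff: "\<And>X Y. X \<in> vector_fields M \<Longrightarrow> Y \<in> vector_fields M \<Longrightarrow> f (X - Y) = f X - f Y"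
    and X: "X \<in> vector_fields M" and Y: "Y \<in> vector_fields M"
  shows "nijenhuis f X Y = cov_deriv nab (f X) f Y - cov_deriv nab (f Y) f X
      + f (cov_deriv nab Y f X) - f (cov_deriv nab X f Y)"
  unfolding nijenhuis_def cov_deriv_def
  using X Y by (simp add: f nab f_diff flip: torsion)

locale sasakian_derivative = weak_almost_contact +
  fixes nab
  assumes levi_civita: "levi_civita_connection M g nab"
    and cov_deriv_f: "X \<in> vector_fields M \<Longrightarrow> Y \<in> vector_fields M \<Longrightarrow>
      cov_deriv nab X f Y = g X Y \<odot> \<xi> - \<eta> Y \<odot> X"
begin

lemma nab_vf [simp]: "X \<in> vector_fields M \<Longrightarrow> Y \<in> vector_fields M \<Longrightarrow> nab X Y \<in> vector_fields M"
  using levi_civita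
  by (simp add: levi_civita_connection_def affine_connection_def tensor_1_1_def)

lemma torsion_free: "X \<in> vector_fields M \<Longrightarrow> Y \<in> vector_fields M \<Longrightarrow>
    nab X Y - nab Y X = lie_bracket X Y"
  and metric_compatible: "X \<in> vector_fields M \<Longrightarrow> Y \<in> vector_fields M \<Longrightarrow> Z \<in> vector_fields M \<Longrightarrow>
    vf_apply X (g Y Z) = g (nab X Y) Z + g Y (nab X Z)"
  using levi_civita by (simp_all add: levi_civita_connection_def)

lemma lie_bracket_vf [simp]:
  "X \<in> vector_fields M \<Longrightarrow> Y \<in> vector_fields M \<Longrightarrow> lie_bracket X Y \<in> vector_fields M"
  by (simp flip: torsion_free)

lemma nab_zero:
  assumes X: "X \<in> vector_fields M"
  shows "nab X 0 = 0"
proof (rule additive_on_vector_fields(1)[OF manifold _ xi_vf, where F = "nab X"])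
  show "nab X (Y + Z) = nab X Y + nab X Z"
    if "Y \<in> vector_fields M" "Z \<in> vector_fields M" for Y Z
    using levi_civita X that unfolding levi_civita_connection_def affine_connection_def by blast
qed

lemma nab_f:
  assumes "X \<in> vector_fields M" "Y \<in> vector_fields M"
  shows "nab X (f Y) = g X Y \<odot> \<xi> - \<eta> Y \<odot> X + f (nab X Y)"
  using cov_deriv_f[OF assms] by (simp add: cov_deriv_def algebra_simps)

lemma eta_nab_xi:
  assumes X: "X \<in> vector_fields M"
  shows "\<eta> (nab X \<xi>) = 0"
proof -
  have "vf_apply X (g \<xi> \<xi>) = 0"
    using X by (intro vf_apply_one[OF manifold]) (simp_all add: eta_xi flip: eta_eq)
  then show ?thesis
    using metric_compatible[OF X xi_vf xi_vf] X g_sym[of "nab X \<xi>" \<xi>] by (simp add: eta_eq fun_eq_iff)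
qed

text \<open>Let \<open>b = \<eta>(f \<xi>)\<close> and \<open>w = f \<xi> - b \<xi>\<close>. The functions \<open>g(f \<xi>, f \<xi>)\<close> and \<open>- \<eta>(f (f \<xi>))\<close>
  agree, but the formula for \<open>\<nabla> f\<close> yields \<open>- 2 g(X, w)\<close> for the derivative of the former along
  \<open>X\<close> and \<open>- g(X, w)\<close> for that of the latter, since the terms in \<open>\<nabla>\<^sub>X \<xi>\<close> are multiples of
  \<open>\<eta>(\<nabla>\<^sub>X \<xi>) = 0\<close>. Hence \<open>g(X, w) = 0\<close>. For \<open>X = f \<xi>\<close> this says \<open>g(f \<xi>, f \<xi>) = b\<^sup>2\<close>, while
  \<open>- \<eta>(f (f \<xi>)) = - b\<^sup>2\<close> by proportionality.\<close>

lemma eta_f_xi_eq_zero: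
  assumes proportional: "\<And>Y. Y \<in> vector_fields M \<Longrightarrow> \<eta> (f Y) = \<eta> (f \<xi>) * \<eta> Y"
  shows "\<eta> (f \<xi>) = 0"
proof -
  define b where "b = \<eta> (f \<xi>)"
  note proportional = proportional[folded b_def]
  have f_xi: "g (f X) (f \<xi>) = - b * b * \<eta> X" if X: "X \<in> vector_fields M" for X
  proof -
    have "g (f X) (f \<xi>) = - \<eta> (f (f X))"
      using X g_sym[of "f X" "f \<xi>"] by (simp add: g_f_f_swap eta_eq)
    then show ?thesis using X by (simp add: proportional algebra_simps)
  qed
  have orth: "g X (f \<xi>) = b * \<eta> X" if X: "X \<in> vector_fields M" for X
  proof -
    have nab_f_xi: "nab X (f \<xi>) = \<eta> X \<odot> \<xi> - \<eta> \<xi> \<odot> X + f (nab X \<xi>)"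
      using X nab_f[OF X xi_vf] by (simp add: eta_eq g_sym)
    have eta_nab: "\<eta> (nab X (f \<xi>)) = 0"
    proof -
      have "\<eta> (nab X (f \<xi>)) = \<eta> X * \<eta> \<xi> - \<eta> \<xi> * \<eta> X + \<eta> (f (nab X \<xi>))"
        using X by (simp add: nab_f_xi eta_eq g_diff g_add g_scale)
      also have "\<dots> = 0" using X by (simp add: proportional eta_nab_xi)
      finally show ?thesis .
    qed
    have "2 * (b * \<eta> X - g X (f \<xi>)) = 2 * g (f \<xi>) (nab X (f \<xi>))"
    proof -
      have "g (f \<xi>) (f (nab X \<xi>)) = 0"
        using X f_xi[of "nab X \<xi>"] g_sym[of "f \<xi>" "f (nab X \<xi>)"] by (simp add: eta_nab_xi)
      then show ?thesis
        using X by (simp add: nab_f_xi g_diff g_add g_scale eta_xi_mult b_def eta_eq[of "f \<xi>"]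
            g_sym[of "f \<xi>" \<xi>] g_sym[of "f \<xi>" X] mult.commute)
    qed
    also have "\<dots> = vf_apply X (g (f \<xi>) (f \<xi>))"
      using X metric_compatible[of X "f \<xi>" "f \<xi>"] g_sym[of "f \<xi>" "nab X (f \<xi>)"] by simp
    also have "\<dots> = - vf_apply X (g \<xi> (f (f \<xi>)))"
      using X by (simp add: g_f_f_swap vf_apply_minus[OF manifold])
    also have "\<dots> = - (g X (f \<xi>) - b * \<eta> X)"
    proof -
      have "g (nab X \<xi>) (f (f \<xi>)) = 0"
        using X f_xi[of "nab X \<xi>"] g_f_f_swap[of "nab X \<xi>" \<xi>] by (simp add: eta_nab_xi)
      moreover have "\<eta> (f (nab X (f \<xi>))) = 0"
        using X by (simp add: proportional eta_nab)
      moreover have "\<eta> (nab X (f (f \<xi>)))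
          = g X (f \<xi>) * \<eta> \<xi> - b * \<eta> X + \<eta> (f (nab X (f \<xi>)))"
        using X by (simp add: nab_f[of X "f \<xi>"] b_def eta_eq g_diff g_add g_scale)
      ultimately show ?thesis
        using X metric_compatible[of X \<xi> "f (f \<xi>)"] eta_xi_mult[of "g X (f \<xi>)"]
        by (simp add: eta_eq[of "nab X (f (f \<xi>))"] mult.commute)
    qed
    finally show ?thesis
      by (simp add: fun_eq_iff)
  qed
  have "b * b = - (b * b)"
  proof -
    have "b * b = g (f \<xi>) (f \<xi>)" using orth[of "f \<xi>"] by (simp add: b_def)
    also have "\<dots> = - (b * b) * \<eta> \<xi>" using f_xi[OF xi_vf] by simp
    also have "\<dots> = - (b * b)"
      using arg_cong[OF eta_xi_mult[of b], of "\<lambda>\<phi>. \<phi> * b"] by (simp add: b_def mult_ac)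
    finally show ?thesis .
  qed
  then show ?thesis by (simp add: b_def fun_eq_iff)
qed

text \<open>As \<open>f \<xi> = 0\<close>, the formula for \<open>(\<nabla>\<^sub>X f) \<xi>\<close> determines \<open>f (\<nabla>\<^sub>X \<xi>)\<close>. Applying \<open>f\<close> again recovers
  \<open>\<nabla>\<^sub>X \<xi>\<close>, because it is orthogonal to \<open>\<xi>\<close>.\<close>

lemma nab_xi:
  assumes f_f: "\<And>X. X \<in> vector_fields M \<Longrightarrow> f (f X) = - X + \<eta> X \<odot> \<xi>"
    and f_xi: "f \<xi> = 0" and X: "X \<in> vector_fields M"
  shows "nab X \<xi> = - f X"
proof -
  have "\<eta> X \<odot> \<xi> - \<eta> \<xi> \<odot> X + f (nab X \<xi>) = 0"
    using nab_f[OF X xi_vf] X by (simp add: f_xi nab_zero eta_eq g_sym)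
  then have "f (nab X \<xi>) = X - \<eta> X \<odot> \<xi>"
    using X by (simp add: eta_xi_scale)
      (simp add: algebra_simps eq_neg_iff_add_eq_0)
  then have "f (f (nab X \<xi>)) = f X - \<eta> X \<odot> f \<xi>"
    using X by (simp add: f_diff f_scale)
  moreover have "f (f (nab X \<xi>)) = - nab X \<xi>"
    using X by (simp add: f_f eta_nab_xi vf_scale_def fun_eq_iff)
  ultimately show ?thesis
    by (simp add: f_xi vf_scale_def fun_eq_iff minus_equation_iff)
qed

text \<open>Metric compatibility and vanishing torsion turn the derivatives and the bracket in \<open>d\<eta>\<close> into
  covariant derivatives, of which those of \<open>X\<close> and \<open>Y\<close> cancel.\<close>

lemma ext_deriv_eta:
  assumes X: "X \<in> vector_fields M" and Y: "Y \<in> vector_fields M"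
  shows "ext_deriv \<eta> X Y p = (g (nab X \<xi>) Y p - g (nab Y \<xi>) X p) / 2"
  using X Y metric_compatible[of X \<xi> Y] metric_compatible[of Y \<xi> X]
  by (simp add: ext_deriv_def eta_eq g_diff flip: torsion_free)

lemma sasakian_if_Q_identity:
  assumes Q_id: "\<And>X. X \<in> vector_fields M \<Longrightarrow> Q X = X"
    and eta_f: "\<And>X. X \<in> vector_fields M \<Longrightarrow> \<eta> (f X) = 0"
  shows "sasakian M f \<xi> \<eta> g"
proof -
  have f_f_id: "f (f X) = - X + \<eta> X \<odot> \<xi>" if "X \<in> vector_fields M" for X
    using that by (simp add: f_f Q_id)
  have skew: "g (f X) Y = - g X (f Y)"
    if X: "X \<in> vector_fields M" and Y: "Y \<in> vector_fields M" for X Y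
  proof -
    have "Y = \<eta> Y \<odot> \<xi> - f (f Y)" using Y by (simp add: f_f_id)
    then have "g (f X) Y = g (f X) (\<eta> Y \<odot> \<xi> - f (f Y))" by simp
    also have "\<dots> = - g (f X) (f (f Y))"
      using X Y eta_f[OF X] by (simp add: g_diff g_scale eta_eq g_sym[of "f X" \<xi>])
    also have "\<dots> = - g X (f Y)"
      using X Y eta_f[OF Y] by (simp add: g_f_f Q_id)
    finally show ?thesis .
  qed
  have d_eta: "ext_deriv \<eta> X Y = g X (f Y)"
    if X: "X \<in> vector_fields M" and Y: "Y \<in> vector_fields M" for X Y
  proof -
    have nab_xi': "nab Z \<xi> = - f Z" if "Z \<in> vector_fields M" for Z
      by (rule nab_xi) (use that f_f_id f_xi_eq_zero[OF eta_f] in auto)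
    have "g (nab X \<xi>) Y = g X (f Y)" "g (nab Y \<xi>) X = - g X (f Y)"
      using X Y skew[of X Y] g_sym[of "f Y" X] g_sym[of "- f X" Y] g_sym[of "f X" Y]
        g_sym[of "- f Y" X] vector_fields_minus[OF manifold]
      by (simp_all add: nab_xi' g_minus)
    then show ?thesis using X Y by (simp add: fun_eq_iff ext_deriv_eta)
  qed
  have normal: "nijenhuis f X Y + (\<lambda>p. 2 * ext_deriv \<eta> X Y p) \<odot> \<xi> = 0"
    if X: "X \<in> vector_fields M" and Y: "Y \<in> vector_fields M" for X Y
  proof -
    have "nijenhuis f X Y = cov_deriv nab (f X) f Y - cov_deriv nab (f Y) f X
        + f (cov_deriv nab Y f X) - f (cov_deriv nab X f Y)"
      using X Y by (intro nijenhuis_cov_deriv) (simp_all add: torsion_free f_diff)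
    moreover have "f (cov_deriv nab Y f X) - f (cov_deriv nab X f Y) = \<eta> Y \<odot> f X - \<eta> X \<odot> f Y"
      using X Y g_sym[of Y X] by (simp add: cov_deriv_f f_diff f_scale)
    ultimately show ?thesis
      using X Y g_sym[of "f Y" X] skew[of X Y]
      by (simp add: cov_deriv_f d_eta vf_scale_def fun_eq_iff algebra_simps)
  qed
  have "weak_almost_contact_metric M f (\<lambda>X. X) \<xi> \<eta> g"
    using wacm Q_id by (auto simp: weak_almost_contact_metric_def nonsingular_tensor_def
        tensor_1_1_def bij_betw_def inj_on_def)
  then show ?thesis
    using d_eta normal by (simp add: sasakian_def contact_metric_def almost_contact_metric_def)
qed

end


section \<open>Weak quasi-contact metric manifolds with the Sasakian derivative\<close>

theorem theorem2:
  fixes M :: "('m, 'e::euclidean_space) manifold" and n :: nat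
    and f Q :: "'m vfield \<Rightarrow> 'm vfield" and \<xi> :: "'m vfield"
    and \<eta> :: "'m vfield \<Rightarrow> 'm \<Rightarrow> real"
    and g :: "'m vfield \<Rightarrow> 'm vfield \<Rightarrow> 'm \<Rightarrow> real"
    and nab :: "'m vfield \<Rightarrow> 'm vfield \<Rightarrow> 'm vfield"
  assumes "smooth_manifold (2 * n + 1) M"
    and "levi_civita_connection M g nab"
    and "weak_quasi_contact_metric M nab f Q \<xi> \<eta> g"
    and "\<forall>X\<in>vector_fields M. \<forall>Y\<in>vector_fields M.
           cov_deriv nab X f Y = g X Y \<odot> \<xi> - \<eta> Y \<odot> X"
  shows "(\<forall>X\<in>vector_fields M. Q X = X) \<and> sasakian M f \<xi> \<eta> g"
proof -
  interpret sasakian_derivative M "2 * n + 1" f Q \<xi> \<eta> g nab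
    using assms by unfold_locales (simp_all add: weak_quasi_contact_metric_def)
  have h: "tensor_h f \<xi> X \<in> vector_fields M" if "X \<in> vector_fields M" for X
    using that by (simp add: tensor_h_def lie_derivative_def vector_fields_scale_const[OF manifold])
  have quasi: "(g X (Q Y) - g X Y) \<odot> \<xi> = \<eta> (f Y) \<odot> f X - \<eta> Y \<odot> tensor_h f \<xi> X"
    if X: "X \<in> vector_fields M" and Y: "Y \<in> vector_fields M" for X Y
  proof -
    have "cov_deriv nab X f Y + cov_deriv nab (f X) f (f Y)
        = (\<lambda>p. 2 * g X Y p) \<odot> \<xi> - \<eta> Y \<odot> (X + tensor_h f \<xi> X + \<eta> X \<odot> \<xi>)"
      using assms(3) X Y by (simp add: weak_quasi_contact_metric_def)
    then show ?thesis
      using X Y by (simp add: cov_deriv_f g_f_f fun_eq_iff vf_scale_def algebra_simps)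
  qed
  have proportional: "\<eta> (f Y) = \<eta> (f \<xi>) * \<eta> Y" if "Y \<in> vector_fields M" for Y
    using eta_f_proportional[OF h quasi that] .
  have eta_f: "\<eta> (f Y) = 0" if "Y \<in> vector_fields M" for Y
    using proportional[OF that] eta_f_xi_eq_zero[OF proportional] by simp
  have Q_xi: "Q \<xi> = \<xi>"
    using f_f[OF xi_vf] by (simp add: f_xi_eq_zero[OF eta_f] f_zero eta_xi_scale)
  have h_zero: "tensor_h f \<xi> X = 0" if X: "X \<in> vector_fields M" for X
  proof -
    have "\<eta> \<xi> \<odot> tensor_h f \<xi> X = 0"
      using quasi[OF X xi_vf] by (simp add: Q_xi eta_f vf_scale_def fun_eq_iff)
    then show ?thesis using h[OF X] by (simp add: eta_xi_scale)
  qed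
  have g_Q: "g X (Q Y) = g X Y" if X: "X \<in> vector_fields M" and Y: "Y \<in> vector_fields M" for X Y
  proof -
    have "g X (Q Y - Y) \<odot> \<xi> = 0"
      using quasi[OF X Y] X Y by (simp add: g_diff h_zero eta_f vf_scale_def fun_eq_iff)
    moreover have "\<eta> (g X (Q Y - Y) \<odot> \<xi>) = \<eta> \<xi> * g X (Q Y - Y)"
      using X Y by (simp add: eta_eq g_scale mult.commute)
    moreover have "\<eta> 0 = 0"
      using eta_f[OF xi_vf] by (simp add: f_xi_eq_zero[OF eta_f])
    ultimately have "g X (Q Y - Y) = 0"
      using X Y eta_xi_mult[of "g X (Q Y - Y)"] by simp
    then show ?thesis using X Y by (simp add: g_diff)
  qed
  have Q_id: "Q X = X" if X: "X \<in> vector_fields M" for X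
    using vf_eq_zero[of "Q X - X"] X by (simp add: g_diff g_Q)
  then show ?thesis using sasakian_if_Q_identity[OF Q_id eta_f] by simp
qed

end
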